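(* Let $\mathbb F_q$ be a finite field of characteristic $p$, let $S=\operatorname{Spec}\mathbb F_q$, and let $V=(t^{a_1},\dots,t^{a_n})$ and $W=(s^{b_1},\dots,s^{b_n})$, for integers $a_i,b_i\ge 2$ (which may, without loss of generality, be taken coprime to $p$), be two rational curves in $X_{n,S}=X(1)_S^n\cong(\mathbb P^1_S)^n$, parametrized by $t$ and by $s$ respectively. If the numbers $b_i/a_i$ ($1\le i\le n$) are all powers of a fixed rational number $\gamma$, then $\mathscr I(V,W)$ is an infinite set. Moreover, if Artin's conjecture on primitive roots is assumed, then $\mathscr I(V,W)$ is infinite for general (that is, arbitrary) $a_i,b_i\ge 2$, without the assumption that the $b_i/a_i$ are all powers of a fixed rational number.
   Context: $X(1)_S$ is the (proper, coarse) modular curve over $S$, identified with $\mathbb P^1_S$ via the $j$-invariant, and $X_{n,S}=X(1)^n_S$ is its $n$-fold fibre product over $S$, parametrizing products of $n$ (generalized) elliptic curves. Two points $x,y\in X_{n,S}$ are called isogenous if the corresponding semi-abelian varieties $A_x,A_y$ parametrized by $x,y$ are geometrically isogenous. For $V,W\subset X_{n,S}$, $$\mathscr I(V,W)=\{v\in V:\text{ there exists } w\in W \text{ such that } v \text{ is isogenous to } w\}\subset V.$$ Artin's conjecture on primitive roots is used in the form: for any prime $p$ there exist infinitely many primes $\lambda$ such that $p$ is a primitive root modulo $\lambda$. *)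

theory Defs
  imports
    "HOL-Analysis.Finite_Cartesian_Product"
    "HOL-Algebra.Algebraic_Closure_Type"
    "HOL-Number_Theory.Residue_Primitive_Roots"
begin

section \<open>The modular curve \<open>X(1) = P\<^sup>1\<close>\<close>

datatype 'k proj_line = Finite 'k | Infinity

primrec proj_power :: "'k::field proj_line \<Rightarrow> nat \<Rightarrow> 'k proj_line" where
  "proj_power (Finite t) m = Finite (t ^ m)"
| "proj_power Infinity m = (if m = 0 then Finite 1 else Infinity)"


section \<open>Generalized elliptic curves in Weierstrass form\<close>

text \<open>
  The equation is \<open>y\<^sup>2 + a1 x y + a3 y = x\<^sup>3 + a2 x\<^sup>2 + a4 x + a6\<close>; in this form
  the definitions below are valid in every characteristic, including 2 and 3.
\<close>

datatype 'k weierstrass = Weierstrass (a1: 'k) (a2: 'k) (a3: 'k) (a4: 'k) (a6: 'k)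

definition b2 :: "'k::field weierstrass \<Rightarrow> 'k" where
  "b2 E = (a1 E)^2 + 4 * a2 E"

definition b4 :: "'k::field weierstrass \<Rightarrow> 'k" where
  "b4 E = 2 * a4 E + a1 E * a3 E"

definition b6 :: "'k::field weierstrass \<Rightarrow> 'k" where
  "b6 E = (a3 E)^2 + 4 * a6 E"

definition b8 :: "'k::field weierstrass \<Rightarrow> 'k" where
  "b8 E = (a1 E)^2 * a6 E + 4 * a2 E * a6 E - a1 E * a3 E * a4 E
            + a2 E * (a3 E)^2 - (a4 E)^2"

definition c4 :: "'k::field weierstrass \<Rightarrow> 'k" where
  "c4 E = (b2 E)^2 - 24 * b4 E"

definition discr :: "'k::field weierstrass \<Rightarrow> 'k" where
  "discr E = - ((b2 E)^2 * b8 E) - 8 * (b4 E)^3 - 27 * (b6 E)^2 + 9 * b2 E * b4 E * b6 E"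

text \<open>
  A Weierstrass cubic is smooth iff its discriminant is nonzero, and it has a node (rather than
  a cusp) iff its discriminant vanishes but \<open>c4\<close> does not. The nodal cubic is the generalized
  elliptic curve over the cusp \<open>j = \<infinity>\<close>.
\<close>

definition generalized_elliptic :: "'k::field weierstrass \<Rightarrow> bool" where
  "generalized_elliptic E \<longleftrightarrow> discr E \<noteq> 0 \<or> c4 E \<noteq> 0"

definition j_invariant :: "'k::field weierstrass \<Rightarrow> 'k proj_line" where
  "j_invariant E = (if discr E = 0 then Infinity else Finite ((c4 E)^3 / discr E))"


subsection \<open>The group of smooth points\<close>

datatype 'k point = Origin | Affine 'k 'k

definition on_curve :: "'k::field weierstrass \<Rightarrow> 'k \<Rightarrow> 'k \<Rightarrow> bool" where
  "on_curve E x y \<longleftrightarrow>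
     y^2 + a1 E * x * y + a3 E * y = x^3 + a2 E * x^2 + a4 E * x + a6 E"

text \<open>The second condition says that the two partial derivatives do not both vanish.\<close>

definition smooth_at :: "'k::field weierstrass \<Rightarrow> 'k \<Rightarrow> 'k \<Rightarrow> bool" where
  "smooth_at E x y \<longleftrightarrow> on_curve E x y \<and>
     (2 * y + a1 E * x + a3 E \<noteq> 0 \<or> a1 E * y \<noteq> 3 * x^2 + 2 * a2 E * x + a4 E)"

text \<open>
  For a smooth cubic this is the set of all points of the elliptic curve; for a nodal cubic it is
  the complement of the node, a one-dimensional torus.
\<close>

definition points :: "'k::field weierstrass \<Rightarrow> 'k point set" where
  "points E = insert Origin {Affine x y | x y. smooth_at E x y}"

text \<open>
  The chord-and-tangent law. The line through the two points, or the tangent line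
  if they coincide, has slope \<open>l\<close>.
\<close>

fun add_points :: "'k::field weierstrass \<Rightarrow> 'k point \<Rightarrow> 'k point \<Rightarrow> 'k point" where
  "add_points E Origin Q = Q"
| "add_points E P Origin = P"
| "add_points E (Affine x1 y1) (Affine x2 y2) =
    (if x1 = x2 \<and> y1 + y2 + a1 E * x2 + a3 E = 0 then Origin
     else
       let l = (if x1 = x2
                then (3 * x1^2 + 2 * a2 E * x1 + a4 E - a1 E * y1) / (2 * y1 + a1 E * x1 + a3 E)
                else (y2 - y1) / (x2 - x1));
           x3 = l^2 + a1 E * l - a2 E - x1 - x2;
           y3 = - (y1 + l * (x3 - x1)) - a1 E * x3 - a3 E
       in Affine x3 y3)"


section \<open>Products of generalized elliptic curves and their isogenies\<close>

text \<open>
  A family \<open>A\<close> of generalized elliptic curves indexed by \<open>'n\<close> stands for the semi-abelian variety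
  that is the product of the smooth loci of its members.
\<close>

definition product_points :: "('n \<Rightarrow> 'k::field weierstrass) \<Rightarrow> ('n \<Rightarrow> 'k point) set" where
  "product_points A = {P. \<forall>i. P i \<in> points (A i)}"

text \<open>Homogeneous coordinates \<open>[X : Y : Z]\<close> in the projective plane; \<open>Z\<close> is the last one.\<close>

definition mk_coords :: "'k \<Rightarrow> 'k \<Rightarrow> 'k \<Rightarrow> 'k ^ 3" where
  "mk_coords x y z = (\<chi> i. if i = 1 then x else if i = 2 then y else z)"

primrec std_coords :: "'k::field point \<Rightarrow> 'k ^ 3" where
  "std_coords Origin = mk_coords 0 1 0"
| "std_coords (Affine x y) = mk_coords x y 1"

definition has_coords :: "'k::field point \<Rightarrow> 'k ^ 3 \<Rightarrow> bool" where
  "has_coords P v \<longleftrightarrow> (\<exists>c. c \<noteq> 0 \<and> v = c *s std_coords P)"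

text \<open>
  Multihomogeneous polynomials in the coordinates of a product of projective planes, viewed as
  functions of the coordinate vectors (over an infinite field these are the same thing).
  The first argument is the multidegree; 0 has every multidegree.
\<close>

inductive multihomogeneous ::
  "('n \<Rightarrow> nat) \<Rightarrow> (('n \<Rightarrow> 'k::field ^ 3) \<Rightarrow> 'k) \<Rightarrow> bool" where
  const: "multihomogeneous (\<lambda>_. 0) (\<lambda>_. c)"
| coord: "multihomogeneous (\<lambda>i'. if i' = i then 1 else 0) (\<lambda>v. v i $ r)"
| add: "multihomogeneous d F \<Longrightarrow> multihomogeneous d G \<Longrightarrow>
    multihomogeneous d (\<lambda>v. F v + G v)"
| mult: "multihomogeneous d F \<Longrightarrow> multihomogeneous e G \<Longrightarrow>
    multihomogeneous (\<lambda>i. d i + e i) (\<lambda>v. F v * G v)"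

text \<open>
  Morphisms of (locally closed) subvarieties of products of projective planes over an algebraically
  closed field: each component is given, on a basic open neighbourhood \<open>G \<noteq> 0\<close> of each point, by
  three polynomials of a common multidegree without common zero there.
\<close>

definition product_morphism ::
  "('n \<Rightarrow> 'k::alg_closed_field weierstrass) \<Rightarrow> ('n \<Rightarrow> 'k weierstrass) \<Rightarrow>
   (('n \<Rightarrow> 'k point) \<Rightarrow> ('n \<Rightarrow> 'k point)) \<Rightarrow> bool" where
  "product_morphism A B f \<longleftrightarrow>
     f ` product_points A \<subseteq> product_points B \<and>
     (\<forall>i. \<forall>P\<in>product_points A. \<exists>d e F G.
        (\<forall>r. multihomogeneous d (F r)) \<and> multihomogeneous e G \<and>
        G (\<lambda>j. std_coords (P j)) \<noteq> 0 \<and>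
        (\<forall>Q\<in>product_points A. G (\<lambda>j. std_coords (Q j)) \<noteq> 0 \<longrightarrow>
           has_coords (f Q i) (\<chi> r. F r (\<lambda>j. std_coords (Q j)))))"

text \<open>Isogenies are the surjective homomorphisms with finite kernel; they may be inseparable.\<close>

definition product_isogeny ::
  "('n \<Rightarrow> 'k::alg_closed_field weierstrass) \<Rightarrow> ('n \<Rightarrow> 'k weierstrass) \<Rightarrow>
   (('n \<Rightarrow> 'k point) \<Rightarrow> ('n \<Rightarrow> 'k point)) \<Rightarrow> bool" where
  "product_isogeny A B f \<longleftrightarrow>
     product_morphism A B f \<and>
     (\<forall>P\<in>product_points A. \<forall>Q\<in>product_points A.
        f (\<lambda>i. add_points (A i) (P i) (Q i)) = (\<lambda>i. add_points (B i) (f P i) (f Q i))) \<and>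
     f ` product_points A = product_points B \<and>
     finite {P \<in> product_points A. f P = (\<lambda>_. Origin)}"

text \<open>
  \<open>A\<close> is a semi-abelian variety parametrized by the geometric point \<open>x\<close> of \<open>X(1)\<^sup>n\<close>. As \<open>X(1)\<close> is
  a coarse moduli space, \<open>x\<close> determines it up to isomorphism.
\<close>

definition parametrized_by ::
  "('n \<Rightarrow> 'k::field weierstrass) \<Rightarrow> ('n \<Rightarrow> 'k proj_line) \<Rightarrow> bool" where
  "parametrized_by A x \<longleftrightarrow> (\<forall>i. generalized_elliptic (A i) \<and> j_invariant (A i) = x i)"

definition geom_isogenous ::
  "('n \<Rightarrow> 'k::alg_closed_field proj_line) \<Rightarrow> ('n \<Rightarrow> 'k proj_line) \<Rightarrow> bool" where
  "geom_isogenous x y \<longleftrightarrow>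
     (\<exists>A B f. parametrized_by A x \<and> parametrized_by B y \<and> product_isogeny A B f)"


section \<open>Closed points over a finite field\<close>

text \<open>
  A type \<open>'f\<close> of class \<open>finite_field\<close> is \<open>F\<^sub>q\<close>, and \<open>'f alg_closure\<close> is its
  algebraic closure. Closed points of \<open>X(1)\<^sup>n\<close> over \<open>F\<^sub>q\<close> are the Galois orbits of
  geometric points.
\<close>

definition galois :: "('f::field alg_closure \<Rightarrow> 'f alg_closure) set" where
  "galois = {\<sigma>. bij \<sigma> \<and> (\<forall>x y. \<sigma> (x + y) = \<sigma> x + \<sigma> y) \<and> (\<forall>x y. \<sigma> (x * y) = \<sigma> x * \<sigma> y) \<and>
                 (\<forall>c. \<sigma> (to_ac c) = to_ac c)}"

definition closed_point ::
  "('n \<Rightarrow> 'f::field alg_closure proj_line) \<Rightarrow> ('n \<Rightarrow> 'f alg_closure proj_line) set" where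
  "closed_point x = {\<lambda>i. map_proj_line \<sigma> (x i) | \<sigma>. \<sigma> \<in> galois}"

text \<open>
  Over a finite field this does not depend on the geometric points chosen above \<open>x\<close> and \<open>y\<close>:
  a geometric point is isogenous to its conjugates via Frobenius.
\<close>

definition isogenous ::
  "('n \<Rightarrow> 'f::finite_field alg_closure proj_line) set \<Rightarrow>
   ('n \<Rightarrow> 'f alg_closure proj_line) set \<Rightarrow> bool" where
  "isogenous x y \<longleftrightarrow> (\<exists>x'\<in>x. \<exists>y'\<in>y. geom_isogenous x' y')"

definition isogeny_locus ::
  "('n \<Rightarrow> 'f::finite_field alg_closure proj_line) set set \<Rightarrow>
   ('n \<Rightarrow> 'f alg_closure proj_line) set set \<Rightarrow>
   ('n \<Rightarrow> 'f alg_closure proj_line) set set" where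
  "isogeny_locus V W = {v \<in> V. \<exists>w\<in>W. isogenous v w}"

text \<open>The closed points of the image of \<open>t \<mapsto> (t ^ a i)\<^sub>i\<close>, with \<open>t\<close> in the projective line.\<close>

definition power_curve ::
  "('n \<Rightarrow> nat) \<Rightarrow> ('n \<Rightarrow> 'f::finite_field alg_closure proj_line) set set" where
  "power_curve a = range (\<lambda>t. closed_point (\<lambda>i. proj_power t (a i)))"


section \<open>Artin's conjecture\<close>

definition artin_conjecture :: bool where
  "artin_conjecture \<longleftrightarrow>
     (\<forall>p::nat. prime p \<longrightarrow> infinite {l::nat. prime l \<and> residue_primroot l p})"

end

theory Submission
  imports Defs
begin

text \<open>
  The only isogenies needed are products of powers of Frobenius \<open>x \<mapsto> x ^ p ^ k\<close>, which raise the
  \<open>j\<close>-invariant to the power \<open>p ^ k\<close>; the exponent may differ from factor to factor. Let \<open>m\<close> be prime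
  to \<open>p\<close> and such that each \<open>b i\<close> is congruent to some \<open>a i * p ^ k\<close> modulo \<open>m\<close>. Then for every \<open>m\<close>-th
  root of unity \<open>t\<close> the points of \<open>V\<close> and \<open>W\<close> with the same parameter \<open>t\<close> are isogenous, so infinitely
  many such \<open>m\<close> suffice. Under Artin's conjecture the large primes modulo which \<open>p\<close> is a primitive root
  will do. If \<open>b i / a i\<close> are powers of \<open>u / v\<close>, where \<open>p\<close> may be removed from \<open>u\<close> and \<open>v\<close>, then
  \<open>m = p ^ c * v - u\<close> works, because \<open>u / v\<close> is \<open>p ^ c\<close> modulo \<open>m\<close>.
\<close>

section \<open>Twisting a Weierstrass curve by a field automorphism\<close>

text \<open>Two kinds of maps are instances: powers of Frobenius, which give the isogenies, and
  elements of \<open>galois\<close>, which move geometric points within a closed point.\<close>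

locale field_automorphism =
  fixes \<phi> :: "'k::field \<Rightarrow> 'k"
  assumes hom_add: "\<phi> (x + y) = \<phi> x + \<phi> y"
    and hom_mult: "\<phi> (x * y) = \<phi> x * \<phi> y"
    and bij: "bij \<phi>"
begin

lemma hom_eq_iff: "\<phi> x = \<phi> y \<longleftrightarrow> x = y"
  using bij by (auto simp: bij_def inj_eq)

lemma hom_0: "\<phi> 0 = 0"
  using hom_add[of 0 0] by (metis add.right_neutral add_left_imp_eq)

lemma hom_eq_0_iff: "\<phi> x = 0 \<longleftrightarrow> x = 0"
  using hom_eq_iff[of x 0] by (simp add: hom_0)

lemma hom_1: "\<phi> 1 = 1"
  using hom_mult[of 1 1] hom_eq_0_iff[of 1] by simp

lemma hom_minus: "\<phi> (- x) = - \<phi> x"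
  using hom_add[of x "- x"] by (simp add: hom_0 eq_neg_iff_add_eq_0 add.commute)

lemma hom_diff: "\<phi> (x - y) = \<phi> x - \<phi> y"
  using hom_add[of x "- y"] by (simp add: hom_minus)

lemma hom_power: "\<phi> (x ^ n) = \<phi> x ^ n"
  by (induction n) (simp_all add: hom_1 hom_mult)

lemma hom_of_nat: "\<phi> (of_nat n) = of_nat n"
  by (induction n) (simp_all add: hom_0 hom_1 hom_add)

lemma hom_numeral: "\<phi> (numeral n) = numeral n"
  using hom_of_nat[of "numeral n"] by simp

lemma hom_divide: "\<phi> (x / y) = \<phi> x / \<phi> y"
proof (cases "y = 0")
  case False
  then have "\<phi> (x / y) * \<phi> y = \<phi> x"
    by (simp flip: hom_mult)
  with False show ?thesis
    by (simp add: hom_eq_0_iff field_simps)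
qed (simp add: hom_0)

lemmas hom_simps = hom_0 hom_1 hom_add hom_mult hom_minus hom_diff hom_power hom_numeral hom_divide

lemma map_weierstrass_sel:
  "a1 (map_weierstrass \<phi> E) = \<phi> (a1 E)" "a2 (map_weierstrass \<phi> E) = \<phi> (a2 E)"
  "a3 (map_weierstrass \<phi> E) = \<phi> (a3 E)" "a4 (map_weierstrass \<phi> E) = \<phi> (a4 E)"
  "a6 (map_weierstrass \<phi> E) = \<phi> (a6 E)"
  by (cases E; simp)+

lemma c4_map: "c4 (map_weierstrass \<phi> E) = \<phi> (c4 E)"
  by (simp add: c4_def b2_def b4_def map_weierstrass_sel hom_simps)

lemma discr_map: "discr (map_weierstrass \<phi> E) = \<phi> (discr E)"
  by (simp add: discr_def b2_def b4_def b6_def b8_def map_weierstrass_sel hom_simps)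

lemma generalized_elliptic_map:
  "generalized_elliptic (map_weierstrass \<phi> E) \<longleftrightarrow> generalized_elliptic E"
  by (simp add: generalized_elliptic_def c4_map discr_map hom_eq_0_iff)

lemma j_invariant_map:
  "j_invariant (map_weierstrass \<phi> E) = map_proj_line \<phi> (j_invariant E)"
  by (simp add: j_invariant_def c4_map discr_map hom_eq_0_iff hom_divide hom_power)

lemma on_curve_map: "on_curve (map_weierstrass \<phi> E) (\<phi> x) (\<phi> y) \<longleftrightarrow> on_curve E x y"
  by (simp add: on_curve_def map_weierstrass_sel flip: hom_simps) (simp add: hom_eq_iff)

lemma smooth_at_map: "smooth_at (map_weierstrass \<phi> E) (\<phi> x) (\<phi> y) \<longleftrightarrow> smooth_at E x y"
proof -
  have "2 * \<phi> y + \<phi> (a1 E) * \<phi> x + \<phi> (a3 E) = \<phi> (2 * y + a1 E * x + a3 E)"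
    and "3 * (\<phi> x)\<^sup>2 + 2 * \<phi> (a2 E) * \<phi> x + \<phi> (a4 E) = \<phi> (3 * x\<^sup>2 + 2 * a2 E * x + a4 E)"
    and "\<phi> (a1 E) * \<phi> y = \<phi> (a1 E * y)"
    by (simp_all add: hom_simps)
  then show ?thesis
    by (simp add: smooth_at_def on_curve_map map_weierstrass_sel hom_eq_iff hom_eq_0_iff)
qed

lemma map_point_mem_iff: "map_point \<phi> P \<in> points (map_weierstrass \<phi> E) \<longleftrightarrow> P \<in> points E"
  by (cases P) (auto simp: points_def smooth_at_map)

lemma map_point_eq_Origin_iff: "map_point \<phi> P = Origin \<longleftrightarrow> P = Origin"
  by (cases P) auto

lemma map_point_surj: "\<exists>P. map_point \<phi> P = Q"
proof (cases Q)
  case Origin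
  then show ?thesis by (intro exI[of _ Origin]) simp
next
  case (Affine x y)
  moreover obtain x' y' where "x = \<phi> x'" "y = \<phi> y'"
    using bij by (metis bij_pointE)
  ultimately show ?thesis by (intro exI[of _ "Affine x' y'"]) simp
qed

text \<open>The chord-and-tangent formulas are rational with integer coefficients, and injectivity
  of \<open>\<phi>\<close> preserves the distinction between vertical, tangent and secant
  lines.\<close>

lemma add_points_map:
  "map_point \<phi> (add_points E P Q) =
     add_points (map_weierstrass \<phi> E) (map_point \<phi> P) (map_point \<phi> Q)"
proof (cases "P = Origin \<or> Q = Origin")
  case True
  then show ?thesis by (cases P; cases Q) auto
next
  case False
  then obtain x1 y1 x2 y2 where PQ: "P = Affine x1 y1" "Q = Affine x2 y2"
    by (cases P; cases Q) auto
  have "\<phi> y1 + \<phi> y2 + \<phi> (a1 E) * \<phi> x2 + \<phi> (a3 E) = \<phi> (y1 + y2 + a1 E * x2 + a3 E)"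
    by (simp add: hom_simps)
  then have *: "\<phi> x1 = \<phi> x2 \<and> \<phi> y1 + \<phi> y2 + \<phi> (a1 E) * \<phi> x2 + \<phi> (a3 E) = 0 \<longleftrightarrow>
      x1 = x2 \<and> y1 + y2 + a1 E * x2 + a3 E = 0"
    by (simp add: hom_eq_iff hom_eq_0_iff)
  show ?thesis
    unfolding PQ point.map add_points.simps map_weierstrass_sel * Let_def
    by (simp add: hom_eq_iff hom_simps if_distrib[of \<phi>] cong: if_cong)
qed

end

section \<open>Factorwise power maps as isogenies of products\<close>

lemma multihomogeneous_coord_power:
  "multihomogeneous (\<lambda>i'. if i' = i then n else 0) (\<lambda>v::'n \<Rightarrow> 'k::field ^ 3. (v i $ r) ^ n)"
proof (induction n)
  case 0
  then show ?case using multihomogeneous.const[of 1] by (simp cong: if_cong)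
next
  case (Suc n)
  have "(\<lambda>i'. (if i' = i then 1 else 0) + (if i' = i then n else 0)) =
      (\<lambda>i'. if i' = i then Suc n else 0)"
    by auto
  with multihomogeneous.mult[OF multihomogeneous.coord Suc] show ?case
    by (metis (no_types, lifting) power_Suc ext)
qed

text \<open>Such a power map is polynomial in the coordinates and commutes with the group laws.
  Being bijective on points, it is surjective with trivial kernel.\<close>

lemma product_isogeny_power_map:
  fixes A :: "'n \<Rightarrow> 'k::alg_closed_field weierstrass"
  assumes aut: "\<And>i. field_automorphism (\<lambda>x::'k. x ^ q i)" and q: "\<And>i. q i > 0"
  shows "product_isogeny A (\<lambda>i. map_weierstrass (\<lambda>x. x ^ q i) (A i))
           (\<lambda>P i. map_point (\<lambda>x. x ^ q i) (P i))"
    (is "product_isogeny A ?B ?f")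
proof -
  have surj: "?f ` product_points A = product_points ?B"
  proof (intro equalityI subsetI)
    fix Q assume Q: "Q \<in> product_points ?B"
    have "\<exists>P. \<forall>i. map_point (\<lambda>x. x ^ q i) (P i) = Q i"
      by (intro choice allI field_automorphism.map_point_surj[OF aut])
    then obtain P where P: "\<And>i. map_point (\<lambda>x. x ^ q i) (P i) = Q i" by blast
    have "P i \<in> points (A i)" for i
      using Q by (subst field_automorphism.map_point_mem_iff[OF aut[of i], symmetric])
        (simp add: P product_points_def)
    then show "Q \<in> ?f ` product_points A"
      by (intro image_eqI[of _ _ P]) (auto simp: P product_points_def)
  qed (auto simp: product_points_def field_automorphism.map_point_mem_iff[OF aut])
  have coords: "has_coords (?f Q i) (\<chi> r. (std_coords (Q i) $ r) ^ q i)" for Q i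
  proof -
    have "(\<chi> r. (std_coords (Q i) $ r) ^ q i) = std_coords (?f Q i)"
      using q[of i] by (cases "Q i") (auto simp: vec_eq_iff mk_coords_def power_0_left)
    then show ?thesis
      unfolding has_coords_def by (intro exI[of _ 1]) simp
  qed
  have "product_morphism A ?B ?f"
    unfolding product_morphism_def
  proof (intro conjI allI ballI)
    fix i P
    show "\<exists>d e F G.
        (\<forall>r. multihomogeneous d (F r)) \<and> multihomogeneous e G \<and>
        G (\<lambda>j. std_coords (P j)) \<noteq> 0 \<and>
        (\<forall>Q\<in>product_points A. G (\<lambda>j. std_coords (Q j)) \<noteq> 0 \<longrightarrow>
           has_coords (?f Q i) (\<chi> r. F r (\<lambda>j. std_coords (Q j))))"
      \<comment> \<open>The constant \<open>G = 1\<close> works because one triple of polynomials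
        represents the component globally.\<close>
      using multihomogeneous_coord_power[of i "q i"] multihomogeneous.const[of 1] coords
      by (intro exI[of _ "\<lambda>i'. if i' = i then q i else 0"] exI[of _ "\<lambda>_. 0"]
          exI[of _ "\<lambda>r v. (v i $ (r::3)) ^ q i"] exI[of _ "\<lambda>_. 1"]) auto
  qed (use surj in simp)
  moreover have "{P \<in> product_points A. ?f P = (\<lambda>_. Origin)} \<subseteq> {\<lambda>_. Origin}"
    by (auto simp: fun_eq_iff field_automorphism.map_point_eq_Origin_iff[OF aut])
  ultimately show ?thesis
    unfolding product_isogeny_def using surj
    by (auto simp: field_automorphism.add_points_map[OF aut] intro: finite_subset)
qed

text \<open>The witness is the classical curve \<open>y^2 + x y = x^3 - 36 w x - w\<close> with
  \<open>w = 1 / (x - 1728)\<close>, the \<open>x\<close> in \<open>w\<close> being the prescribed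
  invariant. It works in every characteristic, 2 and 3 included.\<close>

lemma exists_weierstrass_j:
  fixes x :: "'k::field"
  assumes "x \<noteq> 0" "x \<noteq> 1728"
  shows "\<exists>E. generalized_elliptic E \<and> j_invariant E = Finite x"
proof -
  define w where "w = 1 / (x - 1728)"
  define E where "E = Weierstrass 1 0 0 (- 36 * w) (- w)"
  have w: "w \<noteq> 0" "1 + 1728 * w = x * w"
    using assms by (simp_all add: w_def field_simps)
  have c4: "c4 E = 1 + 1728 * w"
    by (simp add: c4_def b2_def b4_def E_def)
  have discr: "discr E = w * (1 + 1728 * w)\<^sup>2"
    by (simp add: discr_def b2_def b4_def b6_def b8_def E_def power2_eq_square power3_eq_cube
        algebra_simps)
  have "discr E \<noteq> 0"
    using assms w by (simp add: discr)
  moreover have "(c4 E)^3 / discr E = x"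
    using assms(1) w(1) unfolding c4 discr w(2) by (simp add: power2_eq_square power3_eq_cube)
  ultimately show ?thesis
    by (intro exI[of _ E]) (simp add: generalized_elliptic_def j_invariant_def)
qed


section \<open>Frobenius and roots of unity in positive characteristic\<close>

lemma field_automorphism_frobenius:
  fixes p :: nat
  assumes p: "p = CHAR('k::alg_closed_field)" "prime p"
  shows "field_automorphism (\<lambda>x::'k. x ^ p ^ k)"
proof
  fix x y :: 'k
  show add: "(x + y) ^ p ^ k = x ^ p ^ k + y ^ p ^ k" for x y :: 'k
    using freshmans_dream'[of "p ^ k" k x y] p by simp
  show "(x * y) ^ p ^ k = x ^ p ^ k * y ^ p ^ k"
    by (rule power_mult_distrib)
  have pos: "p ^ k > 0" using p(2) by (simp add: prime_gt_0_nat)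
  have "inj (\<lambda>x::'k. x ^ p ^ k)"
  proof (rule injI)
    fix x y :: 'k assume "x ^ p ^ k = y ^ p ^ k"
    \<comment> \<open>Additivity at \<open>x - y\<close> and \<open>y\<close> gives
      \<open>(x - y) ^ p ^ k = 0\<close>.\<close>
    with add[of "x - y" y] show "x = y" using pos by simp
  qed
  moreover have "surj (\<lambda>x::'k. x ^ p ^ k)"
    using nth_root_exists[OF pos] by (metis surjI)
  ultimately show "bij (\<lambda>x::'k. x ^ p ^ k)" by (simp add: bij_def)
qed

text \<open>\<open>X^m - 1\<close> splits into linear factors and is separable: a double root
  \<open>t\<close> would be a root of the derivative \<open>m X^(m-1)\<close>, but \<open>t\<close>
  and \<open>m\<close> are nonzero in the field.\<close>

lemma card_roots_of_unity_alg_closed: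
  assumes m: "of_nat m \<noteq> (0 :: 'k::alg_closed_field)"
  shows "card {t::'k. t ^ m = 1} = m"
proof -
  define P :: "'k poly" where "P = monom 1 m - 1"
  have m0: "m > 0" using m by (cases m) auto
  have deg: "degree P = m" and lc: "lead_coeff P = 1"
  proof -
    have "degree (- 1 + monom 1 m :: 'k poly) = m"
      using m0 by (subst degree_add_eq_right) (auto simp: degree_monom_eq)
    then show "degree P = m" by (simp add: P_def)
    then show "lead_coeff P = 1" using m0 by (simp add: P_def)
  qed
  then have "P \<noteq> 0" by auto
  then obtain A where A: "size A = m" "P = (\<Prod>x\<in>#A. [:- x, 1:])"
    using alg_closed_imp_factorization[of P] deg lc by auto
  have roots: "poly P t = 0 \<longleftrightarrow> t ^ m = 1" for t
    by (simp add: P_def poly_monom)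
  have root_iff: "t ^ m = 1 \<longleftrightarrow> t \<in># A" for t
    by (subst roots[symmetric]) (auto simp: A(2) poly_prod_mset)
  have "count A t \<le> 1" for t
  proof (rule ccontr)
    assume "\<not> count A t \<le> 1"
    then have "t \<in># A" and "t \<in># A - {#t#}"
      by (auto simp flip: count_greater_zero_iff)
    then obtain B where "A = {#t, t#} + B"
      by (metis add_mset_add_single insert_DiffM union_commute union_mset_add_mset_left)
    then have "P = [:- t, 1:] * ([:- t, 1:] * (\<Prod>x\<in>#B. [:- x, 1:]))"
      unfolding A(2) by (simp del: mult_pCons_left)
    then have "poly (pderiv P) t = 0"
      by (simp add: pderiv_mult pderiv_pCons del: mult_pCons_left)
    moreover have "poly (pderiv P) t = of_nat m * t ^ (m - 1)"
      by (simp add: P_def pderiv_diff pderiv_monom poly_monom)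
    moreover have "t \<noteq> 0"
      using \<open>t \<in># A\<close> m0 by (auto simp flip: root_iff simp: power_0_left)
    ultimately show False using m by simp
  qed
  then have "A = mset_set (set_mset A)"
    by (intro multiset_eqI) (metis count_mset_set(1,3) finite_set_mset le_antisym
        count_greater_eq_one_iff not_in_iff)
  moreover have "set_mset A = {t. t ^ m = 1}"
    using root_iff by auto
  ultimately show ?thesis
    using A(1) by (metis size_mset_set)
qed

lemma finite_nth_roots:
  fixes c :: "'k::idom"
  assumes "m > 0"
  shows "finite {t. t ^ m = c}"
proof -
  have "monom 1 m - [:c:] \<noteq> 0"
  proof
    assume "monom 1 m - [:c:] = 0"
    then have "degree (monom (1::'k) m) = degree [:c:]" by simp
    with assms show False by (simp add: degree_monom_eq)
  qed
  from poly_roots_finite[OF this] show ?thesis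
    by (simp add: poly_monom)
qed

section \<open>Geometric points in a Galois orbit\<close>

lemma closed_point_refl:
  fixes x :: "'n \<Rightarrow> 'f::field alg_closure proj_line"
  shows "x \<in> closed_point x"
proof -
  have "id \<in> (galois :: ('f alg_closure \<Rightarrow> _) set)"
    by (auto simp: galois_def)
  then show ?thesis
    unfolding closed_point_def by (intro CollectI exI[of _ id]) (simp add: proj_line.map_id)
qed

lemma galois_hom_power:
  assumes "\<sigma> \<in> galois"
  shows "\<sigma> (x ^ n) = \<sigma> x ^ n" and "\<sigma> 1 = 1"
proof -
  interpret field_automorphism \<sigma>
    using assms by unfold_locales (auto simp: galois_def)
  show "\<sigma> (x ^ n) = \<sigma> x ^ n" "\<sigma> 1 = 1" by (rule hom_power hom_1)+
qed


section \<open>Infinitely many isogenous pairs\<close>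

text \<open>Roots of unity of order dividing some \<open>m\<close> in \<open>M\<close>, outside a
  finite set \<open>D\<close>, give points of the locus. There are infinitely many of them, and only
  finitely many share a closed point.\<close>

lemma infinite_isogeny_locus:
  fixes a b :: "'n::finite \<Rightarrow> nat"
  assumes a: "\<And>i. a i > 0"
    and M: "infinite M"
    and cop: "\<And>m. m \<in> M \<Longrightarrow> coprime m CHAR('f)"
    and cong: "\<And>m i. m \<in> M \<Longrightarrow> \<exists>k. [a i * CHAR('f) ^ k = b i] (mod m)"
  shows "infinite (isogeny_locus (power_curve a)
           (power_curve b :: ('n \<Rightarrow> 'f::finite_field alg_closure proj_line) set set))"
proof
  define p where "p = CHAR('f)"
  have p: "prime p" by (simp add: p_def)
  have pc: "p = CHAR('f alg_closure)" by (simp add: p_def)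
  let ?L = "isogeny_locus (power_curve a) (power_curve b) ::
    ('n \<Rightarrow> 'f alg_closure proj_line) set set"
  define c where "c t = closed_point (\<lambda>i. proj_power (Finite t) (a i))" for t :: "'f alg_closure"
  define T where "T = (\<Union>m\<in>M. {t::'f alg_closure. t ^ m = 1})"
  \<comment> \<open>\<open>exists_weierstrass_j\<close> omits \<open>j = 1728\<close>.\<close>
  define D where "D = (\<Union>i. {t::'f alg_closure. t ^ a i = 1728})"
  assume fin: "finite ?L"
  have Mpos: "m > 0" if "m \<in> M" for m
    using cop[OF that] p by (intro Nat.gr0I) (auto simp: p_def)
  have card: "card {t::'f alg_closure. t ^ m = 1} = m" if "m \<in> M" for m
  proof (rule card_roots_of_unity_alg_closed)
    have "\<not> p dvd m"
      using cop[OF that] p by (metis p_def coprime_common_divisor dvd_refl not_prime_unit)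
    then show "of_nat m \<noteq> (0 :: 'f alg_closure)"
      by (simp add: of_nat_eq_0_iff_char_dvd p_def)
  qed
  have "infinite T"
  proof
    assume T: "finite T"
    \<comment> \<open>\<open>T\<close> contains \<open>m\<close> distinct \<open>m\<close>-th roots
      of unity for each \<open>m\<close> in \<open>M\<close>, so a finite \<open>T\<close> would
      bound \<open>M\<close>.\<close>
    have "m \<le> card T" if "m \<in> M" for m
      using card_mono[OF T, of "{t. t ^ m = 1}"] card[OF that] that by (auto simp: T_def)
    with M show False
      by (meson finite_nat_set_iff_bounded_le)
  qed
  moreover have "finite D"
    unfolding D_def using a by (intro finite_UN_I finite_nth_roots) auto
  ultimately have "infinite (T - D)" by simp
  have mem: "c t \<in> ?L" if t: "t \<in> T - D" for t
  proof -
    obtain m where m: "m \<in> M" "t ^ m = 1" using t by (auto simp: T_def)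
    have "t \<noteq> 0" using m Mpos[OF m(1)] by (auto simp: power_0_left)
    then have "\<forall>i. \<exists>E. generalized_elliptic E \<and> j_invariant E = Finite (t ^ a i)"
      using t by (intro allI exists_weierstrass_j) (auto simp: D_def)
    then obtain A where A: "\<And>i. generalized_elliptic (A i)" "\<And>i. j_invariant (A i) = Finite (t ^ a i)"
      by metis
    obtain k where k: "\<And>i. [a i * p ^ k i = b i] (mod m)"
      using cong[OF m(1)] unfolding p_def by metis
    \<comment> \<open>Exponents of \<open>t\<close> matter only modulo \<open>m\<close>. Hence the
      Frobenius power \<open>p ^ k i\<close> carries the \<open>j\<close>-invariant
      \<open>t ^ a i\<close> to \<open>t ^ b i\<close>.\<close>
    have tb: "t ^ (a i * p ^ k i) = t ^ b i" for i
    proof -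
      have "t ^ n = t ^ (n mod m)" for n
      proof -
        have "t ^ n = t ^ (m * (n div m) + n mod m)" by simp
        also have "\<dots> = t ^ (n mod m)" by (simp only: power_add power_mult m(2)) simp
        finally show ?thesis .
      qed
      then show ?thesis using k[of i] by (metis cong_def)
    qed
    note aut = field_automorphism_frobenius[OF pc p]
    have "geom_isogenous (\<lambda>i. proj_power (Finite t) (a i)) (\<lambda>i. proj_power (Finite t) (b i))"
      unfolding geom_isogenous_def
    proof (intro exI conjI)
      show "parametrized_by A (\<lambda>i. proj_power (Finite t) (a i))"
        by (simp add: parametrized_by_def A)
      show "parametrized_by (\<lambda>i. map_weierstrass (\<lambda>x. x ^ p ^ k i) (A i))
          (\<lambda>i. proj_power (Finite t) (b i))"
        by (simp add: parametrized_by_def field_automorphism.generalized_elliptic_map[OF aut]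
            field_automorphism.j_invariant_map[OF aut] A tb flip: power_mult)
      show "product_isogeny A (\<lambda>i. map_weierstrass (\<lambda>x. x ^ p ^ k i) (A i))
          (\<lambda>P i. map_point (\<lambda>x. x ^ p ^ k i) (P i))"
        using p by (intro product_isogeny_power_map aut) (simp add: prime_gt_0_nat)
    qed
    then have "isogenous (c t) (closed_point (\<lambda>i. proj_power (Finite t) (b i)))"
      unfolding isogenous_def c_def using closed_point_refl by blast
    then show ?thesis
      unfolding isogeny_locus_def power_curve_def c_def by blast
  qed
  have fib: "finite {t' \<in> T - D. c t' = c t}" if t: "t \<in> T - D" for t
  proof -
    obtain m where m: "m \<in> M" "t ^ m = 1" using t by (auto simp: T_def)
    \<comment> \<open>An arbitrary index: one coordinate suffices, since every conjugate of the
      \<open>m\<close>-th root of unity \<open>t ^ a i\<close> is again an \<open>m\<close>-th root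
      of unity.\<close>
    define i :: 'n where "i = undefined"
    have "t' ^ (a i * m) = 1" if "c t' = c t" for t'
    proof -
      have "(\<lambda>i. proj_power (Finite t') (a i)) \<in> c t"
        unfolding that[symmetric] unfolding c_def by (rule closed_point_refl)
      then obtain \<sigma> where \<sigma>: "\<sigma> \<in> galois"
          "(\<lambda>i. proj_power (Finite t') (a i)) = (\<lambda>i. map_proj_line \<sigma> (proj_power (Finite t) (a i)))"
        by (auto simp: c_def closed_point_def)
      from fun_cong[OF \<sigma>(2), of i] have "t' ^ a i = \<sigma> (t ^ a i)" by simp
      then have "t' ^ (a i * m) = \<sigma> ((t ^ a i) ^ m)"
        by (simp add: galois_hom_power[OF \<sigma>(1)] power_mult)
      also have "(t ^ a i) ^ m = (t ^ m) ^ a i"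
        by (simp add: mult.commute flip: power_mult)
      finally show ?thesis by (simp add: m(2) galois_hom_power[OF \<sigma>(1)])
    qed
    moreover have "finite {t' :: 'f alg_closure. t' ^ (a i * m) = 1}"
      using a[of i] Mpos[OF m(1)] by (intro finite_nth_roots) simp
    ultimately show ?thesis
      by (elim finite_subset[rotated]) auto
  qed
  have "finite (c ` (T - D))"
    using fin mem by (meson finite_subset image_subsetI)
  from pigeonhole_infinite[OF \<open>infinite (T - D)\<close> this]
  obtain t where "t \<in> T - D" "infinite {t' \<in> T - D. c t' = c t}"
    by blast
  with fib show False by blast
qed


section \<open>Exponents congruent up to powers of the characteristic\<close>

text \<open>By Euler's theorem the inverse of \<open>p ^ s\<close> modulo \<open>m\<close> is itself
  a power of \<open>p\<close>, so all powers of \<open>p\<close> can be moved to one side.\<close>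

lemma cong_mult_prime_power_one_sided:
  fixes p m x y :: nat
  assumes "coprime m p" "[x * p ^ r = y * p ^ s] (mod m)"
  shows "\<exists>k. [x * p ^ k = y] (mod m)"
proof (cases "m = 0")
  case True
  \<comment> \<open>Coprimality of 0 and \<open>p\<close> forces \<open>p = 1\<close>.\<close>
  with assms show ?thesis by (intro exI[of _ 0]) (simp add: cong_def)
next
  case False
  then have "s + s * (totient m - 1) = totient m * s"
    by (cases "totient m") auto
  then have "p ^ s * p ^ (s * (totient m - 1)) = (p ^ totient m) ^ s"
    by (simp flip: power_add power_mult)
  also have "[\<dots> = 1 ^ s] (mod m)"
    using assms(1) by (intro cong_pow euler_theorem) (simp add: coprime_commute)
  finally have 1: "[p ^ s * p ^ (s * (totient m - 1)) = 1] (mod m)" by simp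
  have "[x * p ^ r * p ^ (s * (totient m - 1)) = y * p ^ s * p ^ (s * (totient m - 1))] (mod m)"
    by (rule cong_scalar_right[OF assms(2)])
  also have "[y * p ^ s * p ^ (s * (totient m - 1)) = y] (mod m)"
    using cong_scalar_left[OF 1, of y] by (simp add: mult.assoc)
  finally show ?thesis by (auto simp: mult.assoc simp flip: power_add)
qed

text \<open>The common base is, up to a power of \<open>p\<close>, a fraction \<open>u' / v'\<close>
  prime to \<open>p\<close>. Modulo \<open>p ^ N * v' - u'\<close> this fraction becomes
  \<open>p ^ N\<close>, hence every ratio becomes a power of \<open>p\<close>.\<close>

lemma infinite_moduli_power_ratio:
  fixes a b :: "'n \<Rightarrow> nat" and \<gamma> :: rat
  assumes p: "prime (p::nat)" and a: "\<And>i. a i > 0" and b: "\<And>i. b i > 0"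
    and \<gamma>: "\<And>i. \<exists>k::int. of_nat (b i) / of_nat (a i) = \<gamma> powi k"
  shows "infinite {m. coprime m p \<and> (\<forall>i. \<exists>k. [a i * p ^ k = b i] (mod m))}"
    (is "infinite ?M")
proof -
  \<comment> \<open>\<open>\<gamma>\<close> may be negative, or \<open>0\<close> when all exponents are \<open>0\<close>, as \<open>0 powi 0 = 1\<close>.\<close>
  have "\<exists>\<delta>>0::rat. \<forall>i. \<exists>k::int. of_nat (b i) / of_nat (a i) = \<delta> powi k"
  proof (cases "\<gamma> = 0")
    case True
    have "of_nat (b i) / of_nat (a i) = (1::rat)" for i
      using \<gamma>[of i] a[of i] b[of i] by (auto simp: True power_int_0_left_if split: if_splits)
    then have "of_nat (b i) / of_nat (a i) = (1::rat) powi 0" for i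
      by (simp only: power_int_0_right)
    then show ?thesis by (intro exI[of _ 1] conjI allI exI[of _ 0] zero_less_one)
  next
    case False
    have "\<exists>k. of_nat (b i) / of_nat (a i) = \<bar>\<gamma>\<bar> powi k" for i
    proof -
      obtain k where "of_nat (b i) / of_nat (a i) = \<gamma> powi k" using \<gamma> by blast
      then have "\<bar>of_nat (b i) / of_nat (a i)\<bar> = \<bar>\<gamma>\<bar> powi k" by (simp add: power_int_abs)
      then show ?thesis by auto
    qed
    with False show ?thesis by (intro exI[of _ "\<bar>\<gamma>\<bar>"]) simp
  qed
  then obtain \<delta> :: rat where \<delta>: "\<delta> > 0" "\<And>i. \<exists>k. of_nat (b i) / of_nat (a i) = \<delta> powi k"
    by blast
  obtain u v :: nat where uv: "\<delta> = of_nat u / of_nat v" "u > 0" "v > 0" "coprime u v"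
  proof -
    obtain x y where xy: "quotient_of \<delta> = (x, y)" by force
    have "y > 0" "\<delta> = of_int x / of_int y" "coprime x y"
      using quotient_of_denom_pos[OF xy] quotient_of_div[OF xy] quotient_of_coprime[OF xy] by auto
    moreover from this \<delta>(1) have "x > 0" by (simp add: zero_less_divide_iff)
    ultimately show thesis
      by (intro that[of "nat x" "nat y"]) (auto simp: coprime_nat_abs_left_iff nat_eq_iff coprime_int_iff[symmetric])
  qed
  obtain e u' where u': "u = p ^ e * u'" "\<not> p dvd u'"
    using prime_power_canonical[OF p uv(2)] by (metis mult.commute)
  obtain f v' where v': "v = p ^ f * v'" "\<not> p dvd v'"
    using prime_power_canonical[OF p uv(3)] by (metis mult.commute)
  have pos: "u' > 0" "v' > 0" using u' v' uv by (auto intro: Nat.gr0I)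
  have cop: "coprime u' v'" using uv(4) by (simp add: u' v')
  \<comment> \<open>The exponent is large enough that the subtraction is not truncated and
    \<open>m c > c\<close>. Being positive, it also makes \<open>m c\<close> prime to
    \<open>p\<close>, as \<open>p\<close> does not divide \<open>u'\<close>.\<close>
  define m where "m c = p ^ Suc (c + u') * v' - u'" for c
  have gt: "p ^ Suc (c + u') * v' > c + u'" for c
  proof -
    have "c + u' < p ^ (c + u')" using prime_gt_1_nat[OF p] by (intro power_gt_expt) simp
    also have "\<dots> \<le> p ^ Suc (c + u') * v'" using pos p by (simp add: prime_gt_0_nat Suc_le_eq)
    finally show ?thesis .
  qed
  have "m c \<in> ?M" for c
  proof -
    have m: "m c + u' = p ^ Suc (c + u') * v'" using gt[of c] by (simp add: m_def)
    have key: "[u' = p ^ Suc (c + u') * v'] (mod m c)"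
      unfolding m[symmetric] by (simp add: cong_def)
    have copp: "coprime (m c) p"
    proof -
      have "\<not> p dvd m c"
      proof
        assume "p dvd m c"
        moreover have "p dvd m c + u'" unfolding m by simp
        ultimately show False using u'(2) dvd_add_right_iff by blast
      qed
      then show ?thesis using p by (metis coprime_commute prime_imp_coprime)
    qed
    have copv: "coprime (m c) v'"
    proof (rule coprimeI)
      fix d assume d: "d dvd m c" "d dvd v'"
      then have "d dvd m c + u'" unfolding m by simp
      with d(1) have "d dvd u'" using dvd_add_right_iff by blast
      with d(2) cop show "is_unit d" by (rule coprime_common_divisor[OF _ _ , rotated -1])
    qed
    \<comment> \<open>In the cleared-denominator equation, \<open>u'\<close> is replaced by its
      congruent value; then \<open>v' ^ n\<close>, a unit modulo \<open>m c\<close>, cancels and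
      only powers of \<open>p\<close> remain.\<close>
    have pw: "[x * p ^ (e * n + Suc (c + u') * n) = y * p ^ (f * n)] (mod m c)"
      if "x * u ^ n = y * v ^ n" for x y n
    proof -
      have "[x * p ^ (e * n) * (p ^ Suc (c + u') * v') ^ n = x * p ^ (e * n) * u' ^ n] (mod m c)"
        by (intro cong_mult cong_refl cong_pow cong_sym[OF key])
      also have "x * p ^ (e * n) * u' ^ n = y * p ^ (f * n) * v' ^ n"
        using that by (simp add: u' v' power_mult_distrib power_mult mult.assoc)
      finally have "[x * p ^ (e * n + Suc (c + u') * n) * v' ^ n = y * p ^ (f * n) * v' ^ n] (mod m c)"
        by (simp only: power_mult_distrib power_mult power_add mult.assoc)
      then show ?thesis
        using copv by (subst (asm) cong_mult_rcancel_nat) (simp_all add: coprime_commute)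
    qed
    have "\<exists>k. [a i * p ^ k = b i] (mod m c)" for i
    proof -
      obtain k where k: "of_nat (b i) / of_nat (a i) = \<delta> powi k" using \<delta>(2) by blast
      show ?thesis
      proof (cases "k \<ge> 0")
        case True
        then obtain n where "k = int n" by (metis nonneg_int_cases)
        with k have "of_nat (a i * u ^ n) = (of_nat (b i * v ^ n) :: rat)"
          using a[of i] uv by (simp add: power_int_of_nat power_divide field_simps)
        then have "a i * u ^ n = b i * v ^ n" by (simp only: of_nat_eq_iff)
        from pw[OF this] copp show ?thesis by (intro cong_mult_prime_power_one_sided)
      next
        \<comment> \<open>For a negative exponent \<open>a i\<close> and \<open>b i\<close> trade
          places in the equation, so \<open>pw\<close> is used in reverse.\<close>
        case False
        then obtain n where "k = - int n" by (metis nonneg_int_cases neg_equal_iff_equal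
            add.inverse_inverse le_cases neg_le_0_iff_le neg_0_le_iff_le)
        with k have "of_nat (b i * u ^ n) = (of_nat (a i * v ^ n) :: rat)"
          using a[of i] uv by (simp add: power_int_minus power_divide field_simps)
        then have "b i * u ^ n = a i * v ^ n" by (simp only: of_nat_eq_iff)
        from cong_sym[OF pw[OF this]] copp show ?thesis
          by (intro cong_mult_prime_power_one_sided)
      qed
    qed
    with copp show ?thesis by blast
  qed
  moreover have "m c > c" for c
    using gt[of c] by (simp add: m_def)
  ultimately show ?thesis
    by (metis (no_types, lifting) finite_nat_set_iff_bounded less_asym)
qed

text \<open>If \<open>p\<close> is a primitive root modulo a prime \<open>l\<close>, all nonzero
  residues are powers of \<open>p\<close>; this includes every \<open>a i\<close> and
  \<open>b i\<close> once \<open>l\<close> exceeds them.\<close>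

lemma infinite_moduli_artin:
  fixes a b :: "'n::finite \<Rightarrow> nat"
  assumes p: "prime (p::nat)" and a: "\<And>i. a i > 0" and b: "\<And>i. b i > 0"
    and artin: "infinite {l::nat. prime l \<and> residue_primroot l p}"
  shows "infinite {m. coprime m p \<and> (\<forall>i. \<exists>k. [a i * p ^ k = b i] (mod m))}"
proof -
  define N where "N = (\<Sum>i\<in>UNIV. a i + b i)"
  have "{l. prime l \<and> residue_primroot l p} - {..N} \<subseteq>
      {m. coprime m p \<and> (\<forall>i. \<exists>k. [a i * p ^ k = b i] (mod m))}"
  proof (intro subsetI CollectI conjI allI)
    fix l i
    assume "l \<in> {l. prime l \<and> residue_primroot l p} - {..N}"
    then have l: "prime l" "residue_primroot l p" "l > N" by auto
    show cop: "coprime l p" using l(2) by (simp add: residue_primroot_def)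
    have power: "\<exists>r. [p ^ r = x] (mod l)" if "0 < x" "x < l" for x
    proof -
      have "x \<in> totatives l" using that l(1) by (simp add: totatives_prime)
      then have "x \<in> (\<lambda>i. p ^ i mod l) ` {..<totient l}"
        using residue_primroot_is_generator[OF _ l(2)] prime_gt_1_nat[OF l(1)]
        by (simp add: bij_betw_def)
      then show ?thesis by (auto simp: cong_def)
    qed
    have "a i + b i \<le> N"
      unfolding N_def by (rule member_le_sum) auto
    then have "a i < l" "b i < l" using l(3) by auto
    then obtain r s where rs: "[p ^ r = a i] (mod l)" "[p ^ s = b i] (mod l)"
      using power a b by metis
    \<comment> \<open>Both sides are congruent to \<open>p ^ (r + s)\<close>.\<close>
    then have "[a i * p ^ s = b i * p ^ r] (mod l)"
      by (metis cong_mult cong_sym mult.commute)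
    with cop show "\<exists>k. [a i * p ^ k = b i] (mod l)"
      by (rule cong_mult_prime_power_one_sided)
  qed
  moreover have "infinite ({l. prime l \<and> residue_primroot l p} - {..N})"
    using artin by simp
  ultimately show ?thesis by (rule infinite_super)
qed

theorem theorem2:
  fixes a b :: "'n::finite \<Rightarrow> nat"
    and V W :: "('n \<Rightarrow> 'f::finite_field alg_closure proj_line) set set"
  assumes "\<forall>i. a i \<ge> 2" and "\<forall>i. b i \<ge> 2"
    and "V = power_curve a" and "W = power_curve b"
  shows "((\<exists>\<gamma>::rat. \<forall>i. \<exists>k::int. of_nat (b i) / of_nat (a i) = \<gamma> powi k)
            \<longrightarrow> infinite (isogeny_locus V W)) \<and>
         (artin_conjecture \<longrightarrow> infinite (isogeny_locus V W))"
proof -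
  \<comment> \<open>Both implications reduce to the infinitude of this one set of moduli.\<close>
  let ?M = "{m. coprime m CHAR('f) \<and> (\<forall>i. \<exists>k. [a i * CHAR('f) ^ k = b i] (mod m))}"
  have a: "a i > 0" and b: "b i > 0" for i
    using assms(1,2) by (metis less_le_trans pos2)+
  have "infinite (isogeny_locus V W)" if "infinite ?M"
    unfolding assms(3,4) by (rule infinite_isogeny_locus[OF a that]) auto
  moreover have "infinite ?M"
    if "\<exists>\<gamma>::rat. \<forall>i. \<exists>k::int. of_nat (b i) / of_nat (a i) = \<gamma> powi k"
    using that by (elim exE) (intro infinite_moduli_power_ratio a b, auto)
  moreover have "infinite ?M" if artin_conjecture
    using that by (intro infinite_moduli_artin a b) (simp_all add: artin_conjecture_def)
  ultimately show ?thesis by blast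
qed

end
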